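(* Let $G$ be a connected graph on $n\geq 14$ vertices with minimum degree $\delta\geq 3$. If $$\rho(G)> n-3,$$ then $G$ is Hamilton-connected unless $G\in \{S_{n}^{3},T_{n}^{3}\}$.
   Context: All graphs are finite and simple (no loops or multiple edges); equality of graphs is up to isomorphism. $\delta=\delta(G)$ is the minimum degree of $G$. $\rho(G)$ is the spectral radius of $G$, i.e. the largest eigenvalue of its adjacency matrix $A(G)$. A Hamilton path is a path containing all vertices of $G$; $G$ is Hamilton-connected if every two (distinct) vertices of $G$ are connected by a Hamilton path. $G+H$ and $G\vee H$ denote the disjoint union and the join of $G$ and $H$; $kG$ is the disjoint union of $k$ copies of $G$; $K_n$ is the complete graph on $n$ vertices. The graphs are $$S_{n}^{3}=K_{3}\vee (K_{n-5}+2K_{1}),\qquad T_{n}^{3}=K_{2}\vee (K_{n-4}+K_{2}).$$ *)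

theory Defs
  imports
    "Jordan_Normal_Form.Spectral_Radius"
    "Graph_Theory.Graph_Theory"
begin

text \<open>
  A finite simple graph is a \<^locale>\<open>pair_graph\<close>: finite, symmetric and loop-free, each edge
  \<open>uv\<close> being represented by the two arcs \<open>(u,v)\<close> and \<open>(v,u)\<close>.  Hence the degree of a vertex is its
  out-degree (equal to its in-degree).
\<close>

definition min_degree :: "'a pair_pre_digraph \<Rightarrow> nat" where
  "min_degree G = Min (out_degree (with_proj G) ` pverts G)"

definition adjacency_matrix :: "'a pair_pre_digraph \<Rightarrow> 'a list \<Rightarrow> real mat" where
  "adjacency_matrix G vs =
     mat (length vs) (length vs) (\<lambda>(i, j). if (vs ! i, vs ! j) \<in> parcs G then 1 else 0)"

text \<open>
  The rows and columns are indexed through an enumeration of the vertices. A different enumeration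
  gives a permutation-similar matrix, hence the same spectrum. For a graph this matrix is real
  symmetric, so its real spectrum contains all its eigenvalues.
\<close>

definition graph_spectral_radius :: "'a pair_pre_digraph \<Rightarrow> real" where
  "graph_spectral_radius G =
     Max (spectrum (adjacency_matrix G (SOME vs. distinct vs \<and> set vs = pverts G)))"

definition hamilton_path ::
    "'a pair_pre_digraph \<Rightarrow> 'a \<Rightarrow> ('a \<times> 'a) awalk \<Rightarrow> 'a \<Rightarrow> bool" where
  "hamilton_path G u p v \<longleftrightarrow>
     pre_digraph.apath (with_proj G) u p v \<and>
     set (pre_digraph.awalk_verts (with_proj G) u p) = pverts G"

definition hamilton_connected :: "'a pair_pre_digraph \<Rightarrow> bool" where
  "hamilton_connected G \<longleftrightarrow>
     (\<forall>u \<in> pverts G. \<forall>v \<in> pverts G. u \<noteq> v \<longrightarrow> (\<exists>p. hamilton_path G u p v))"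

definition complete_graph :: "nat \<Rightarrow> nat pair_pre_digraph" where
  "complete_graph n =
     \<lparr> pverts = {0..<n}, parcs = {(i, j). i < n \<and> j < n \<and> i \<noteq> j} \<rparr>"

definition disjoint_union ::
    "'a pair_pre_digraph \<Rightarrow> 'b pair_pre_digraph \<Rightarrow> ('a + 'b) pair_pre_digraph" where
  "disjoint_union G H =
     \<lparr> pverts = pverts G <+> pverts H,
       parcs = {(Inl u, Inl v) | u v. (u, v) \<in> parcs G} \<union>
               {(Inr u, Inr v) | u v. (u, v) \<in> parcs H} \<rparr>"

definition join ::
    "'a pair_pre_digraph \<Rightarrow> 'b pair_pre_digraph \<Rightarrow> ('a + 'b) pair_pre_digraph" where
  "join G H =
     \<lparr> pverts = pverts G <+> pverts H,
       parcs = parcs (disjoint_union G H) \<union>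
               {(Inl u, Inr v) | u v. u \<in> pverts G \<and> v \<in> pverts H} \<union>
               {(Inr v, Inl u) | u v. u \<in> pverts G \<and> v \<in> pverts H} \<rparr>"

definition copies :: "nat \<Rightarrow> 'a pair_pre_digraph \<Rightarrow> (nat \<times> 'a) pair_pre_digraph" where
  "copies k G =
     \<lparr> pverts = {0..<k} \<times> pverts G,
       parcs = {((i, u), (i, v)) | i u v. i < k \<and> (u, v) \<in> parcs G} \<rparr>"

text \<open>The subtractions truncate, so the next two graphs are meant for \<open>n \<ge> 5\<close> and \<open>n \<ge> 4\<close>.\<close>

definition S3_graph :: "nat \<Rightarrow> (nat + nat + nat \<times> nat) pair_pre_digraph" where
  "S3_graph n =
     join (complete_graph 3)
       (disjoint_union (complete_graph (n - 5)) (copies 2 (complete_graph 1)))"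

definition T3_graph :: "nat \<Rightarrow> (nat + nat + nat) pair_pre_digraph" where
  "T3_graph n =
     join (complete_graph 2) (disjoint_union (complete_graph (n - 4)) (complete_graph 2))"

end

theory Submission
  imports Defs
begin

text \<open>
  Write \<open>\<rho>\<close> for the spectral radius and \<open>d\<close> for degrees, and count edges as arcs, so that \<open>|E|\<close> is the
  sum of all degrees.

  \<^bold>\<open>Many edges.\<close>  Minimum degree at least \<open>k\<close> gives \<open>\<rho>\<^sup>2 - (k - 1) \<rho> \<le> |E| - (n - 1) k\<close>: the right-hand
  side bounds every row sum of \<open>A\<^sup>2 - (k - 1) A\<close> (\<open>spectral_radius_edge_bound\<close>).  With \<open>k = 3\<close>,
  \<open>\<rho> > n - 3\<close> and the evenness of \<open>|E|\<close> this yields \<open>|E| \<ge> n\<^sup>2 - 5n + 14\<close>.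

  \<^bold>\<open>Few possibilities.\<close>  Suppose that \<open>G\<close> is not Hamilton-connected and let \<open>H\<close> be a supergraph of \<open>G\<close> on
  the same vertices, edge-maximal without being Hamilton-connected.  By the Bondy--Chvatal argument
  (\<open>spanning_path_without_heavy_edge\<close>) non-adjacent vertices of \<open>H\<close> have degree sum at most \<open>n\<close>.  A
  non-adjacent pair of largest degree sum, whose smaller degree is \<open>k\<close>, then forces at least \<open>k - 1\<close>
  vertices of degree at most \<open>k\<close> and at least \<open>n - k\<close> vertices of degree at most \<open>n - k\<close>.  Against the
  number of edges this leaves \<open>k = 3\<close>, or \<open>n = 14\<close> and \<open>k = 7\<close> with equality everywhere.  If \<open>k = 3\<close>, then
  \<open>H\<close> is a clique together with two vertices of degree 3 that have the same neighbours in the clique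
  (\<open>twin_extension\<close>), that is, \<open>S\<^sub>n\<^sup>3\<close> or \<open>T\<^sub>n\<^sup>3\<close> according to whether the two vertices are adjacent
  (\<open>twin_extension_iso\<close>).

  \<^bold>\<open>No edge can be missing.\<close>  If \<open>H\<close> is a twin extension and \<open>G \<noteq> H\<close>, then the minimum degree of \<open>G\<close> puts
  the missing edge inside the clique, and an explicit positive vector \<open>z\<close> with \<open>A z \<le> (n - 3) z\<close> shows
  \<open>\<rho> \<le> n - 3\<close> (\<open>spectral_radius_proper_subgraph_of_twin_extension\<close>).  In the case \<open>n = 14\<close>, \<open>k = 7\<close> the edge
  numbers give \<open>G = H\<close> with minimum degree 7, and the edge bound for minimum degree 7 gives
  \<open>\<rho>\<^sup>2 - 6 \<rho> \<le> 49\<close>, so \<open>\<rho> < 11\<close>.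
\<close>

section \<open>Simple graphs as symmetric relations\<close>

text \<open>
  The argument varies the edge set over a fixed vertex set, so a graph is treated here as a pair of a
  vertex set and a relation.
\<close>

definition simple_graph :: "'a set \<Rightarrow> ('a \<times> 'a) set \<Rightarrow> bool" where
  "simple_graph V E \<longleftrightarrow> finite V \<and> E \<subseteq> V \<times> V \<and> sym E \<and> irrefl E"

abbreviation valency :: "('a \<times> 'a) set \<Rightarrow> 'a \<Rightarrow> nat" where
  "valency E v \<equiv> card (E `` {v})"

lemma simple_graphD:
  assumes "simple_graph V E"
  shows "finite V" "E \<subseteq> V \<times> V" "finite E" "finite (E `` {v})" "E `` {v} \<subseteq> V"
    "(x, y) \<in> E \<Longrightarrow> (y, x) \<in> E" "(x, x) \<notin> E"
proof -
  show *: "finite V" "E \<subseteq> V \<times> V" "(x, y) \<in> E \<Longrightarrow> (y, x) \<in> E" "(x, x) \<notin> E"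
    using assms by (auto simp: simple_graph_def sym_def irrefl_def)
  show "finite E" using * finite_subset[of E "V \<times> V"] by simp
  show "E `` {v} \<subseteq> V" using * by auto
  then show "finite (E `` {v})" using * finite_subset by blast
qed

lemma sum_degree_eq_card:
  assumes "simple_graph V E"
  shows "(\<Sum>v\<in>V. valency E v) = card E"
proof -
  have "E = Sigma V (\<lambda>v. E `` {v})"
    using simple_graphD(2)[OF assms] by auto
  moreover have "card (Sigma V (\<lambda>v. E `` {v})) = (\<Sum>v\<in>V. valency E v)"
    using simple_graphD[OF assms] by (intro card_SigmaI) auto
  ultimately show ?thesis by metis
qed

text \<open>
  The handshake lemma: an injection into the naturals orients every edge, and the two orientations split
  the arcs into two classes of equal size.
\<close>

lemma even_card_edges:
  assumes "simple_graph V E"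
  shows "even (card E)"
proof -
  note GD = simple_graphD[OF assms]
  obtain f :: "'a \<Rightarrow> nat" where f: "inj_on f V"
    using finite_imp_inj_to_nat_seg[OF GD(1)] by blast
  let ?A = "{e \<in> E. f (fst e) < f (snd e)}"
  have "f x \<noteq> f y" if "(x, y) \<in> E" for x y
    using that f GD(2,7) by (auto simp: inj_on_eq_iff)
  then have "E = ?A \<union> ?A\<inverse>"
    using GD(6) by (fastforce simp: neq_iff)
  moreover have "card (?A \<union> ?A\<inverse>) = card ?A + card (?A\<inverse>)"
    using GD(3) by (intro card_Un_disjoint) auto
  ultimately have "card E = 2 * card ?A" by simp
  then show ?thesis by simp
qed

lemma degree_le_card_diff_1:
  assumes "simple_graph V E" "v \<in> V"
  shows "valency E v \<le> card V - 1"
proof -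
  have "E `` {v} \<subseteq> V - {v}"
    using simple_graphD[OF assms(1)] by auto
  then have "valency E v \<le> card (V - {v})"
    using simple_graphD(1)[OF assms(1)] by (intro card_mono) auto
  then show ?thesis using assms(2) by simp
qed

text \<open>The adjacency operator of an undirected graph is self-adjoint.\<close>

lemma sum_neighbours_swap:
  fixes f g :: "'a \<Rightarrow> real"
  assumes "simple_graph V E"
  shows "(\<Sum>v\<in>V. f v * (\<Sum>u\<in>E `` {v}. g u)) = (\<Sum>v\<in>V. g v * (\<Sum>u\<in>E `` {v}. f u))"
proof -
  have nb: "(\<Sum>u\<in>E `` {v}. h u) = (\<Sum>u\<in>V. if (v, u) \<in> E then h u else 0)" for h :: "'a \<Rightarrow> real" and v
    by (rule sum.mono_neutral_cong_left) (use simple_graphD[OF assms] in auto)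
  have "(\<Sum>v\<in>V. f v * (\<Sum>u\<in>E `` {v}. g u)) = (\<Sum>v\<in>V. \<Sum>u\<in>V. if (v, u) \<in> E then f v * g u else 0)"
    by (simp add: nb sum_distrib_left if_distrib cong: if_cong)
  also have "\<dots> = (\<Sum>u\<in>V. \<Sum>v\<in>V. if (u, v) \<in> E then f v * g u else 0)"
    by (subst sum.swap) (intro sum.cong refl if_cong, use simple_graphD(6)[OF assms] in blast)
  also have "\<dots> = (\<Sum>v\<in>V. g v * (\<Sum>u\<in>E `` {v}. f u))"
    by (simp add: nb sum_distrib_left if_distrib mult.commute cong: if_cong)
  finally show ?thesis .
qed

section \<open>Bounds for the spectral radius\<close>

text \<open>
  Needed because the spectral radius is defined as a maximum over the real spectrum, which must therefore
  be shown to be non-empty.  A complex eigenvector is split as \<open>a + \<i> b\<close>; comparing \<open>b \<bullet> A a\<close> with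
  \<open>a \<bullet> A b\<close> gives \<open>Im c * (|a|\<^sup>2 + |b|\<^sup>2) = 0\<close>, so the eigenvalue \<open>c\<close> is real and \<open>a\<close> or \<open>b\<close> is a real
  eigenvector.
\<close>

lemma symmetric_real_mat_has_eigenvalue:
  fixes A :: "real mat"
  assumes A: "A \<in> carrier_mat n n" and n: "n > 0"
    and sym: "\<And>i j. i < n \<Longrightarrow> j < n \<Longrightarrow> A $$ (i, j) = A $$ (j, i)"
  shows "\<exists>k. eigenvalue A k"
proof -
  let ?B = "map_mat complex_of_real A"
  have B: "?B \<in> carrier_mat n n" using A by simp
  obtain c where "eigenvalue ?B c"
    using spectrum_non_empty[OF B n] by (auto simp: spectrum_def)
  then obtain w where w: "w \<in> carrier_vec n" "w \<noteq> 0\<^sub>v n" "?B *\<^sub>v w = c \<cdot>\<^sub>v w"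
    using B by (auto simp: eigenvalue_def eigenvector_def)
  define a where "a i = Re (w $ i)" for i
  define b where "b i = Im (w $ i)" for i
  have comp: "(\<Sum>j<n. of_real (A $$ (i, j)) * w $ j) = c * w $ i" if "i < n" for i
  proof -
    have "(?B *\<^sub>v w) $ i = c * w $ i" using w that by simp
    moreover have "(?B *\<^sub>v w) $ i = (\<Sum>j<n. of_real (A $$ (i, j)) * w $ j)"
      using that A w(1) by (auto simp: scalar_prod_def lessThan_atLeast0 intro!: sum.cong)
    ultimately show ?thesis by simp
  qed
  have re: "(\<Sum>j<n. A $$ (i, j) * a j) = Re c * a i - Im c * b i" if "i < n" for i
    using arg_cong[OF comp[OF that], of Re] by (simp add: a_def b_def)
  have im: "(\<Sum>j<n. A $$ (i, j) * b j) = Re c * b i + Im c * a i" if "i < n" for i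
    using arg_cong[OF comp[OF that], of Im] by (simp add: a_def b_def)
  have "(\<Sum>i<n. b i * (\<Sum>j<n. A $$ (i, j) * a j)) = (\<Sum>i<n. a i * (\<Sum>j<n. A $$ (i, j) * b j))"
    unfolding sum_distrib_left
    by (subst sum.swap) (intro sum.cong refl, use sym in auto)
  then have "(\<Sum>i<n. b i * (Re c * a i - Im c * b i)) = (\<Sum>i<n. a i * (Re c * b i + Im c * a i))"
    using re im by simp
  then have "(\<Sum>i<n. b i * (Re c * a i - Im c * b i) - a i * (Re c * b i + Im c * a i)) = 0"
    by (simp only: sum_subtractf)
  moreover have "b i * (Re c * a i - Im c * b i) - a i * (Re c * b i + Im c * a i)
      = - Im c * ((a i)\<^sup>2 + (b i)\<^sup>2)" for i
    by (simp add: algebra_simps power2_eq_square)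
  ultimately have "Im c * (\<Sum>i<n. (a i)\<^sup>2 + (b i)\<^sup>2) = 0"
    by (simp add: sum_negf flip: sum_distrib_left)
  moreover have "\<exists>i<n. w $ i \<noteq> 0"
    using w(1,2) by (metis carrier_vecD eq_vecI index_zero_vec(1) index_zero_vec(2))
  then obtain m where m: "m < n" "a m \<noteq> 0 \<or> b m \<noteq> 0"
    unfolding a_def b_def by (metis complex_eq_iff zero_complex.sel)
  then have "(\<Sum>i<n. (a i)\<^sup>2 + (b i)\<^sup>2) > 0"
    by (intro sum_pos2[of _ m]) (auto simp: sum_power2_gt_zero_iff)
  ultimately have "Im c = 0" by simp
  have "eigenvalue A (Re c)" if f: "\<And>i. i < n \<Longrightarrow> (\<Sum>j<n. A $$ (i, j) * f j) = Re c * f i" and "f m \<noteq> 0" for f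
  proof -
    have "vec n f \<noteq> 0\<^sub>v n" using that(2) m(1) by (metis index_vec index_zero_vec(1))
    moreover have "A *\<^sub>v vec n f = Re c \<cdot>\<^sub>v vec n f"
      using A f by (intro eq_vecI) (auto simp: scalar_prod_def lessThan_atLeast0 intro!: sum.cong)
    ultimately show ?thesis using A
      by (auto simp: eigenvalue_def eigenvector_def intro!: exI[of _ "vec n f"])
  qed
  then show ?thesis using re im m \<open>Im c = 0\<close> by (metis add.right_neutral diff_zero mult_zero_left)
qed

text \<open>
  Taking absolute values in an eigenvector leaves a non-negative vector \<open>y\<close> with \<open>\<rho> y \<le> A y\<close>.  This
  inequality is all that the two bounds below use of Perron--Frobenius theory.
\<close>

lemma spectral_radius_subeigenvector:
  fixes G :: "'a pair_pre_digraph"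
  assumes G: "simple_graph (pverts G) (parcs G)" and ne: "pverts G \<noteq> {}"
    and nonneg: "graph_spectral_radius G \<ge> 0"
  obtains y :: "'a \<Rightarrow> real" where "\<And>v. v \<in> pverts G \<Longrightarrow> 0 \<le> y v" "(\<Sum>v\<in>pverts G. y v) > 0"
    "\<And>v. v \<in> pverts G \<Longrightarrow> graph_spectral_radius G * y v \<le> (\<Sum>u\<in>parcs G `` {v}. y u)"
proof -
  note GD = simple_graphD[OF G]
  define vs where "vs = (SOME vs. distinct vs \<and> set vs = pverts G)"
  have "\<exists>vs. distinct vs \<and> set vs = pverts G"
    using finite_distinct_list[OF GD(1)] by blast
  then have vs: "distinct vs" "set vs = pverts G"
    unfolding vs_def by (metis (mono_tags, lifting) someI_ex)+
  define n where "n = length vs"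
  define A where "A = adjacency_matrix G vs"
  define r where "r = graph_spectral_radius G"
  have A: "A \<in> carrier_mat n n" by (simp add: A_def adjacency_matrix_def n_def)
  have Aij: "A $$ (i, j) = (if (vs ! i, vs ! j) \<in> parcs G then 1 else 0)" if "i < n" "j < n" for i j
    using that by (simp add: A_def adjacency_matrix_def n_def)
  have "n > 0" using ne vs by (auto simp: n_def)
  have "\<exists>k. eigenvalue A k"
    by (rule symmetric_real_mat_has_eigenvalue[OF A \<open>n > 0\<close>])
      (use Aij GD(6) in auto)
  then have "spectrum A \<noteq> {}" by (auto simp: spectrum_def)
  moreover have "finite (spectrum A)" using card_finite_spectrum[OF A] by simp
  moreover have "r = Max (spectrum A)"
    by (simp add: r_def graph_spectral_radius_def A_def vs_def)
  ultimately have "eigenvalue A r"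
    using Max_in[of "spectrum A"] by (simp add: spectrum_def)
  then obtain w where w: "w \<in> carrier_vec n" "w \<noteq> 0\<^sub>v n" "A *\<^sub>v w = r \<cdot>\<^sub>v w"
    using A by (auto simp: eigenvalue_def eigenvector_def)
  have bij: "bij_betw (\<lambda>i. vs ! i) {..<n} (pverts G)"
    using bij_betw_nth[OF vs(1)] vs(2) n_def by blast
  define y where "y v = \<bar>w $ (inv_into {..<n} (\<lambda>i. vs ! i) v)\<bar>" for v
  have y_nth: "y (vs ! i) = \<bar>w $ i\<bar>" if "i < n" for i
    using bij that by (simp add: y_def bij_betw_inv_into_left)
  have comp: "r * w $ i = (\<Sum>j<n. A $$ (i, j) * w $ j)" if "i < n" for i
  proof -
    have "(A *\<^sub>v w) $ i = r * w $ i" using w that by simp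
    moreover have "(A *\<^sub>v w) $ i = (\<Sum>j<n. A $$ (i, j) * w $ j)"
      using that A w(1) by (auto simp: scalar_prod_def lessThan_atLeast0 intro!: sum.cong)
    ultimately show ?thesis by simp
  qed
  show ?thesis
  proof (rule that)
    show "0 \<le> y v" for v by (simp add: y_def)
    obtain m where m: "m < n" "w $ m \<noteq> 0"
      using w(1,2) by (metis carrier_vecD eq_vecI index_zero_vec(1) index_zero_vec(2))
    then have "y (vs ! m) > 0" "vs ! m \<in> pverts G" using y_nth vs(2) n_def by auto
    then show "(\<Sum>v\<in>pverts G. y v) > 0"
      using GD(1) by (intro sum_pos2[of _ "vs ! m"]) (auto simp: y_def)
    fix v assume "v \<in> pverts G"
    then obtain i where i: "i < n" "v = vs ! i"
      using vs(2) by (metis in_set_conv_nth n_def)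
    have "graph_spectral_radius G * y v = \<bar>r * w $ i\<bar>"
      using nonneg i by (simp add: y_nth r_def abs_mult)
    also have "\<dots> \<le> (\<Sum>j<n. \<bar>A $$ (i, j) * w $ j\<bar>)"
      unfolding comp[OF i(1)] by (rule sum_abs)
    also have "\<dots> = (\<Sum>j<n. if (v, vs ! j) \<in> parcs G then y (vs ! j) else 0)"
      by (intro sum.cong refl) (use i Aij y_nth in auto)
    also have "\<dots> = (\<Sum>u\<in>pverts G. if (v, u) \<in> parcs G then y u else 0)"
      by (rule sum.reindex_bij_betw[OF bij])
    also have "\<dots> = (\<Sum>u\<in>parcs G `` {v}. y u)"
      by (rule sum.mono_neutral_cong_right) (use GD in auto)
    finally show "graph_spectral_radius G * y v \<le> (\<Sum>u\<in>parcs G `` {v}. y u)" .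
  qed
qed

text \<open>
  Pair the sub-eigenvector \<open>y\<close> with \<open>z\<close>: since \<open>A\<close> is self-adjoint,
  \<open>\<rho> (y \<bullet> z) \<le> A y \<bullet> z = y \<bullet> A z \<le> t (y \<bullet> z)\<close>, and \<open>y \<bullet> z > 0\<close>.
\<close>

lemma spectral_radius_le_of_positive_vector:
  fixes G :: "'a pair_pre_digraph" and z :: "'a \<Rightarrow> real"
  assumes G: "simple_graph (pverts G) (parcs G)" and ne: "pverts G \<noteq> {}"
    and t: "t \<ge> 0"
    and pos: "\<And>v. v \<in> pverts G \<Longrightarrow> z v > 0"
    and le: "\<And>v. v \<in> pverts G \<Longrightarrow> (\<Sum>u\<in>parcs G `` {v}. z u) \<le> t * z v"
  shows "graph_spectral_radius G \<le> t"
proof (rule ccontr)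
  let ?r = "graph_spectral_radius G" and ?V = "pverts G"
  assume gt: "\<not> ?r \<le> t"
  obtain y where y: "\<And>v. v \<in> ?V \<Longrightarrow> 0 \<le> y v" "(\<Sum>v\<in>?V. y v) > 0"
    "\<And>v. v \<in> ?V \<Longrightarrow> ?r * y v \<le> (\<Sum>u\<in>parcs G `` {v}. y u)"
    by (rule spectral_radius_subeigenvector[OF G ne]) (use gt t in auto)
  have "(\<Sum>v\<in>?V. z v * (?r * y v)) \<le> (\<Sum>v\<in>?V. z v * (\<Sum>u\<in>parcs G `` {v}. y u))"
    by (intro sum_mono mult_left_mono y(3) less_imp_le[OF pos])
  also have "\<dots> = (\<Sum>v\<in>?V. y v * (\<Sum>u\<in>parcs G `` {v}. z u))"
    by (rule sum_neighbours_swap[OF G])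
  also have "\<dots> \<le> (\<Sum>v\<in>?V. y v * (t * z v))"
    by (intro sum_mono mult_left_mono le y(1))
  finally have "?r * (\<Sum>v\<in>?V. y v * z v) \<le> t * (\<Sum>v\<in>?V. y v * z v)"
    by (simp add: sum_distrib_left mult_ac)
  moreover have "(\<Sum>v\<in>?V. y v * z v) > 0"
  proof -
    obtain v where v: "v \<in> ?V" "y v > 0"
      using y(1,2) by (metis linorder_not_le sum_nonpos)
    then show ?thesis
      using pos y(1) simple_graphD(1)[OF G]
      by (intro sum_pos2[of _ v]) (auto simp: less_imp_le)
  qed
  ultimately show False using gt by simp
qed

text \<open>
  The sum of \<open>d u - (k - 1)\<close> over the neighbours \<open>u\<close> of \<open>v\<close> is a row sum of \<open>A\<^sup>2 - (k - 1) A\<close>.  It equals \<open>d v\<close>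
  plus the sum of \<open>d u - k \<ge> 0\<close> over these neighbours; extending the latter sum to all \<open>u \<noteq> v\<close> gives the
  bound \<open>|E| - (n - 1) k\<close>, which does not depend on \<open>v\<close>.  Weighting the rows with the sub-eigenvector \<open>y\<close>
  turns this into a bound for \<open>\<rho>\<close>; the hypothesis \<open>d \<ge> k\<close> also makes the weights \<open>d - (k - 1)\<close>
  non-negative, so that \<open>\<rho> y \<le> A y\<close> may be applied under them.
\<close>

lemma spectral_radius_edge_bound:
  fixes G :: "'a pair_pre_digraph" and k :: real
  assumes G: "simple_graph (pverts G) (parcs G)" and ne: "pverts G \<noteq> {}"
    and deg: "\<And>v. v \<in> pverts G \<Longrightarrow> k \<le> valency (parcs G) v"
    and r: "graph_spectral_radius G \<ge> k - 1" "graph_spectral_radius G \<ge> 0"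
  shows "(graph_spectral_radius G)\<^sup>2 - (k - 1) * graph_spectral_radius G
           \<le> card (parcs G) - (real (card (pverts G)) - 1) * k"
proof -
  let ?r = "graph_spectral_radius G" and ?V = "pverts G" and ?E = "parcs G"
  let ?d = "\<lambda>v. real (valency ?E v)"
  note GD = simple_graphD[OF G]
  obtain y where y: "\<And>v. v \<in> ?V \<Longrightarrow> 0 \<le> y v" "(\<Sum>v\<in>?V. y v) > 0"
    "\<And>v. v \<in> ?V \<Longrightarrow> ?r * y v \<le> (\<Sum>u\<in>?E `` {v}. y u)"
    by (rule spectral_radius_subeigenvector[OF G ne r(2)]) auto
  define Y where "Y = (\<Sum>v\<in>?V. y v)"
  define S where "S = (\<Sum>v\<in>?V. ?d v * y v)"
  have S: "S = (\<Sum>v\<in>?V. 1 * (\<Sum>u\<in>?E `` {v}. y u))"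
    unfolding S_def by (subst sum_neighbours_swap[OF G]) (simp add: mult.commute)
  have "?r * Y \<le> S"
    unfolding S Y_def sum_distrib_left by (simp add: sum_mono y(3))
  then have "(?r - (k - 1)) * (?r * Y) \<le> (S - (k - 1) * Y) * ?r"
    using r mult_right_mono[of "?r * Y" S ?r] by (simp add: algebra_simps)
  also have "\<dots> = (\<Sum>v\<in>?V. (?d v - (k - 1)) * (?r * y v))"
    unfolding S_def Y_def sum_distrib_left sum_distrib_right sum_subtractf[symmetric]
    by (intro sum.cong refl) (simp add: algebra_simps)
  also have "\<dots> \<le> (\<Sum>v\<in>?V. (?d v - (k - 1)) * (\<Sum>u\<in>?E `` {v}. y u))"
    using deg by (intro sum_mono mult_left_mono y(3)) force+
  also have "\<dots> = (\<Sum>v\<in>?V. y v * (\<Sum>u\<in>?E `` {v}. ?d u - (k - 1)))"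
    by (rule sum_neighbours_swap[OF G])
  also have "\<dots> \<le> (\<Sum>v\<in>?V. y v * (card ?E - (real (card ?V) - 1) * k))"
  proof (intro sum_mono mult_left_mono y(1))
    fix v assume v: "v \<in> ?V"
    have "(\<Sum>u\<in>?E `` {v}. ?d u - (k - 1)) = (\<Sum>u\<in>?E `` {v}. ?d u - k) + ?d v"
      by (simp add: sum.distrib sum_subtractf algebra_simps)
    also have "(\<Sum>u\<in>?E `` {v}. ?d u - k) \<le> (\<Sum>u\<in>?V - {v}. ?d u - k)"
      using GD deg by (intro sum_mono2) auto
    also have "\<dots> = (\<Sum>u\<in>?V. ?d u) - ?d v - (real (card ?V) - 1) * k"
      using v GD(1) card.remove[OF GD(1) v] by (simp add: sum_subtractf sum_diff1 algebra_simps)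
    also have "(\<Sum>u\<in>?V. ?d u) = card ?E"
      using sum_degree_eq_card[OF G] by (metis of_nat_sum)
    finally show "(\<Sum>u\<in>?E `` {v}. ?d u - (k - 1)) \<le> card ?E - (real (card ?V) - 1) * k"
      by simp
  qed
  also have "\<dots> = Y * (card ?E - (real (card ?V) - 1) * k)"
    by (simp add: Y_def sum_distrib_right)
  finally have "Y * (?r\<^sup>2 - (k - 1) * ?r) \<le> Y * (card ?E - (real (card ?V) - 1) * k)"
    by (simp add: algebra_simps power2_eq_square)
  then show ?thesis using y(2) by (simp add: Y_def)
qed

section \<open>Hamilton paths and the closure argument\<close>

definition spanning_path :: "'a set \<Rightarrow> ('a \<times> 'a) set \<Rightarrow> 'a \<Rightarrow> 'a list \<Rightarrow> 'a \<Rightarrow> bool" where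
  "spanning_path V E s p t \<longleftrightarrow> p \<noteq> [] \<and> distinct p \<and> set p = V \<and> hd p = s \<and> last p = t \<and>
     successively (\<lambda>x y. (x, y) \<in> E) p"

definition hamilton_connected_on :: "'a set \<Rightarrow> ('a \<times> 'a) set \<Rightarrow> bool" where
  "hamilton_connected_on V E \<longleftrightarrow> (\<forall>s\<in>V. \<forall>t\<in>V. s \<noteq> t \<longrightarrow> (\<exists>p. spanning_path V E s p t))"

text \<open>
  The rotation step of the closure argument.  Reversing \<open>B\<close> replaces the two edges at its ends and no
  others, so a path that leaves \<open>E\<close> only there becomes a path in \<open>E\<close>.
\<close>

lemma spanning_path_reverse_segment:
  assumes p: "spanning_path V E' s (A @ B @ C) t"
    and ne: "A \<noteq> []" "B \<noteq> []" "C \<noteq> []"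
    and E: "sym E"
    and succ: "successively (\<lambda>x y. (x, y) \<in> E) A" "successively (\<lambda>x y. (x, y) \<in> E) B"
      "successively (\<lambda>x y. (x, y) \<in> E) C"
    and new: "(last A, last B) \<in> E" "(hd B, hd C) \<in> E"
  shows "spanning_path V E s (A @ rev B @ C) t"
proof -
  have "successively (\<lambda>x y. (x, y) \<in> E) (rev B)"
    unfolding successively_rev
    by (rule successively_mono[OF succ(2)]) (use E in \<open>auto dest: symD\<close>)
  then show ?thesis
    using p ne succ new unfolding spanning_path_def
    by (auto simp: successively_append_iff hd_rev last_rev)
qed

text \<open>
  The Bondy--Chvatal step, in its form for paths with prescribed ends.  Let the path use the non-edge as
  \<open>x = p ! i\<close>, \<open>y = p ! Suc i\<close>.  An index \<open>j\<close> for which \<open>x\<close> is adjacent to \<open>p ! j\<close> and \<open>y\<close> to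
  \<open>p ! Suc j\<close> allows the segment between positions \<open>i\<close> and \<open>j\<close> to be reversed, so that these two edges
  replace the one from \<open>x\<close> to \<open>y\<close> and the one from \<open>p ! j\<close> to \<open>p ! Suc j\<close>.  Such an index
  exists by counting: the candidates for \<open>x\<close> and those for \<open>y\<close> all lie among \<open>n - 2\<close> indices, and there are
  at least \<open>d x - 1\<close> and \<open>d y - 1\<close> of them, as only the last vertex is missed for \<open>x\<close> and only the first one
  for \<open>y\<close>.
\<close>

lemma spanning_path_without_heavy_edge:
  assumes G: "simple_graph V E"
    and ab: "a \<in> V" "b \<in> V" "(a, b) \<notin> E"
    and heavy: "card V < valency E a + valency E b"
    and p: "spanning_path V (E \<union> {(a, b), (b, a)}) s p t"
  shows "\<exists>q. spanning_path V E s q t"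
proof (cases "successively (\<lambda>x y. (x, y) \<in> E) p")
  case True
  then show ?thesis using p by (auto simp: spanning_path_def)
next
  case False
  note GD = simple_graphD[OF G]
  define n where "n = length p"
  have d: "distinct p" and V: "set p = V" using p by (auto simp: spanning_path_def)
  have n: "card V = n" using d V by (metis distinct_card n_def)
  have step': "(p ! k, p ! Suc k) \<in> E \<union> {(a, b), (b, a)}" if "Suc k < n" for k
    using p that by (auto simp: spanning_path_def successively_conv_nth n_def)
  obtain i where i: "Suc i < n" "(p ! i, p ! Suc i) \<notin> E"
    using False by (auto simp: successively_conv_nth n_def)
  define x y where "x = p ! i" and "y = p ! Suc i"
  have xy: "(x = a \<and> y = b) \<or> (x = b \<and> y = a)"
    using step'[OF i(1)] i(2) by (auto simp: x_def y_def)
  have xyE: "(x, y) \<notin> E" "(y, x) \<notin> E" using xy ab(3) GD(6) by blast+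
  have heavy': "n < valency E x + valency E y" using heavy xy n by auto
  have "x \<noteq> y" using d i(1) by (simp add: x_def y_def nth_eq_iff_index_eq n_def)
  have step: "(p ! k, p ! Suc k) \<in> E" if "Suc k < n" "k \<noteq> i" for k
  proof (rule ccontr)
    assume "(p ! k, p ! Suc k) \<notin> E"
    then have "{p ! k, p ! Suc k} = {p ! i, p ! Suc i}"
      using step'[OF that(1)] xy by (auto simp: x_def y_def)
    then have "{k, Suc k} = {i, Suc i}"
      using d i(1) that(1) by (auto simp: doubleton_eq_iff nth_eq_iff_index_eq n_def)
    then show False using that(2) by (auto simp: doubleton_eq_iff)
  qed
  define S where "S = {j. Suc j < n \<and> (x, p ! j) \<in> E}"
  define T where "T = {j. Suc j < n \<and> (y, p ! Suc j) \<in> E}"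
  have "S \<subseteq> {..<n}" "T \<subseteq> {..<n}" by (auto simp: S_def T_def)
  then have fin: "finite S" "finite T" using finite_subset by blast+
  have "E `` {x} \<subseteq> insert (p ! (n - 1)) ((!) p ` S)"
  proof
    fix v assume v: "v \<in> E `` {x}"
    then obtain j where j: "j < n" "v = p ! j"
      using GD(5) V by (metis in_set_conv_nth n_def subsetD)
    with v show "v \<in> insert (p ! (n - 1)) ((!) p ` S)"
      by (cases "Suc j < n") (auto simp: S_def intro: arg_cong[of _ _ "(!) p"])
  qed
  then have "valency E x \<le> card (insert (p ! (n - 1)) ((!) p ` S))"
    using fin by (intro card_mono) auto
  also have "\<dots> \<le> Suc (card S)"
    using card_image_le[OF fin(1), of "(!) p"] fin(1) by (simp add: card_insert_if)
  finally have dx: "valency E x \<le> Suc (card S)" .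
  have "E `` {y} \<subseteq> insert (p ! 0) ((\<lambda>j. p ! Suc j) ` T)"
  proof
    fix v assume v: "v \<in> E `` {y}"
    then obtain j where j: "j < n" "v = p ! j"
      using GD(5) V by (metis in_set_conv_nth n_def subsetD)
    with v show "v \<in> insert (p ! 0) ((\<lambda>j. p ! Suc j) ` T)"
      by (cases j) (auto simp: T_def)
  qed
  then have "valency E y \<le> card (insert (p ! 0) ((\<lambda>j. p ! Suc j) ` T))"
    using fin by (intro card_mono) auto
  also have "\<dots> \<le> Suc (card T)"
    using card_image_le[OF fin(2), of "\<lambda>j. p ! Suc j"] fin(2) by (simp add: card_insert_if)
  finally have dy: "valency E y \<le> Suc (card T)" .
  have "S \<union> T \<subseteq> {..<n - 1} - {i}"
    using xyE GD(7) by (auto simp: S_def T_def x_def y_def)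
  then have "card (S \<union> T) \<le> card ({..<n - 1} - {i})" by (intro card_mono) auto
  also have "\<dots> = n - 2" using i(1) by simp
  finally have "S \<inter> T \<noteq> {}"
    using dx dy heavy' i(1) card_Un_disjoint[OF fin] by fastforce
  then obtain j where j: "Suc j < n" "(x, p ! j) \<in> E" "(y, p ! Suc j) \<in> E"
    by (auto simp: S_def T_def)
  have "j \<noteq> i" using j(2) GD(7) by (auto simp: x_def)
  \<comment> \<open>The reversed segment runs from position \<open>Suc m\<close> to position \<open>l\<close>, on either side of \<open>i\<close>.\<close>
  define m l where "m = min i j" and "l = max i j"
  have ml: "m < l" "Suc l < n" using i(1) j(1) \<open>j \<noteq> i\<close> by (auto simp: m_def l_def)
  define A where "A = take (Suc m) p"
  define B where "B = drop (Suc m) (take (Suc l) p)"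
  define C where "C = drop (Suc l) p"
  have p_eq: "p = A @ B @ C"
  proof -
    have "A = take (Suc m) (take (Suc l) p)" using ml by (simp add: A_def min_absorb1)
    then have "A @ B = take (Suc l) p" unfolding B_def by (metis append_take_drop_id)
    then show ?thesis by (metis C_def append.assoc append_take_drop_id)
  qed
  have ne: "A \<noteq> []" "B \<noteq> []" "C \<noteq> []" using ml by (auto simp: A_def B_def C_def n_def)
  have ends: "last A = p ! m" "hd B = p ! Suc m" "last B = p ! l" "hd C = p ! Suc l"
    using ml ne by (auto simp: A_def B_def C_def n_def last_conv_nth hd_drop_conv_nth min_def)
  have keep: "(p ! k, p ! Suc k) \<in> E" if "Suc k < n" "k \<noteq> m" "k \<noteq> l" for k
    using step[OF that(1)] that by (auto simp: m_def l_def min_def max_def split: if_splits)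
  have succ: "successively (\<lambda>x y. (x, y) \<in> E) A" "successively (\<lambda>x y. (x, y) \<in> E) B"
      "successively (\<lambda>x y. (x, y) \<in> E) C"
    using ml by (auto simp: A_def B_def C_def n_def successively_conv_nth intro!: keep[unfolded n_def])
  have new: "(last A, last B) \<in> E" "(hd B, hd C) \<in> E"
    using j GD(6) \<open>j \<noteq> i\<close> unfolding ends
    by (auto simp: m_def l_def x_def y_def min_def max_def)
  have "sym E" using G by (simp add: simple_graph_def)
  then show ?thesis
    using spanning_path_reverse_segment[OF p[unfolded p_eq] ne _ succ new] by blast
qed

lemma hamilton_connected_on_complete:
  assumes "finite V" and "\<And>x y. x \<in> V \<Longrightarrow> y \<in> V \<Longrightarrow> x \<noteq> y \<Longrightarrow> (x, y) \<in> E"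
  shows "hamilton_connected_on V E"
  unfolding hamilton_connected_on_def
proof (intro ballI impI)
  fix s t assume st: "s \<in> V" "t \<in> V" "s \<noteq> t"
  obtain xs where xs: "set xs = V - {s, t}" "distinct xs"
    using finite_distinct_list[of "V - {s, t}"] assms(1) by auto
  let ?p = "s # xs @ [t]"
  have d: "distinct ?p" and V: "set ?p = V" using xs st by auto
  have "successively (\<lambda>x y. (x, y) \<in> E) ?p"
    unfolding successively_conv_nth
  proof (intro allI impI)
    fix i assume i: "Suc i < length ?p"
    then have "?p ! i \<noteq> ?p ! Suc i" using d nth_eq_iff_index_eq[OF d, of i "Suc i"] by linarith
    moreover have "?p ! i \<in> V" "?p ! Suc i \<in> V" using i V nth_mem by (metis Suc_lessD)+
    ultimately show "(?p ! i, ?p ! Suc i) \<in> E" by (rule_tac assms(2))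
  qed
  then have "spanning_path V E s ?p t" using d V by (simp add: spanning_path_def)
  then show "\<exists>p. spanning_path V E s p t" ..
qed


lemma awalk_of_successively:
  assumes "successively (\<lambda>x y. (x, y) \<in> parcs G) (v # vs)"
  shows "pcas v (zip (v # vs) vs) (last (v # vs)) \<and> pawalk_verts v (zip (v # vs) vs) = v # vs
    \<and> set (zip (v # vs) vs) \<subseteq> parcs G"
  using assms
proof (induction vs arbitrary: v)
  case (Cons w vs)
  then show ?case using Cons.IH[of w] by auto
qed auto

lemma hamilton_connected_if_on_arcs:
  assumes "hamilton_connected_on (pverts G) (parcs G)"
  shows "hamilton_connected G"
  unfolding hamilton_connected_def
proof (intro ballI impI)
  fix s t assume st: "s \<in> pverts G" "t \<in> pverts G" "s \<noteq> t"
  then obtain p where p: "spanning_path (pverts G) (parcs G) s p t"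
    using assms unfolding hamilton_connected_on_def by blast
  then obtain vs where vs: "p = s # vs" by (cases p) (auto simp: spanning_path_def)
  let ?q = "zip p vs"
  have "pcas s ?q t \<and> pawalk_verts s ?q = p \<and> set ?q \<subseteq> parcs G"
    using awalk_of_successively[of G s vs] p vs by (simp add: spanning_path_def)
  then have "hamilton_path G s ?q t"
    using p st(1)
    by (simp add: hamilton_path_def pre_digraph.apath_def pre_digraph.awalk_def
        cas_with_proj_eq awalk_verts_with_proj_eq spanning_path_def)
  then show "\<exists>q. hamilton_path G s q t" ..
qed

definition degree_closed :: "'a set \<Rightarrow> ('a \<times> 'a) set \<Rightarrow> bool" where
  "degree_closed V E \<longleftrightarrow> (\<forall>a\<in>V. \<forall>b\<in>V. a \<noteq> b \<longrightarrow> (a, b) \<notin> E \<longrightarrow> valency E a + valency E b \<le> card V)"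

lemma exists_saturated_supergraph:
  assumes G: "simple_graph V E" and not: "\<not> hamilton_connected_on V E"
  obtains H where "E \<subseteq> H" "simple_graph V H" "\<not> hamilton_connected_on V H" "degree_closed V H"
proof -
  let ?F = "{H. E \<subseteq> H \<and> simple_graph V H \<and> \<not> hamilton_connected_on V H}"
  have "?F \<subseteq> Pow (V \<times> V)" by (auto dest: simple_graphD(2))
  then have "finite ?F"
    using simple_graphD(1)[OF G] by (meson finite_Pow_iff finite_SigmaI finite_subset)
  moreover have "E \<in> ?F" using G not by simp
  ultimately obtain H where H: "H \<in> ?F" and max: "\<And>H'. H' \<in> ?F \<Longrightarrow> H \<subseteq> H' \<Longrightarrow> H = H'"
    by (metis (no_types, lifting) finite_has_maximal2)
  show ?thesis
  proof (rule that)
    show "E \<subseteq> H" "simple_graph V H" "\<not> hamilton_connected_on V H" using H by auto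
    show "degree_closed V H" unfolding degree_closed_def
    proof (intro ballI impI)
      fix a b assume ab: "a \<in> V" "b \<in> V" "a \<noteq> b" "(a, b) \<notin> H"
      let ?H = "H \<union> {(a, b), (b, a)}"
      have "simple_graph V ?H"
        using H ab by (auto simp: simple_graph_def sym_def irrefl_def)
      then have "hamilton_connected_on V ?H" using max[of ?H] H ab by blast
      show "valency H a + valency H b \<le> card V"
      proof (rule ccontr)
        assume "\<not> ?thesis"
        then have heavy: "card V < valency H a + valency H b" by simp
        have "hamilton_connected_on V H"
          unfolding hamilton_connected_on_def
        proof (intro ballI impI)
          fix s t assume "s \<in> V" "t \<in> V" "s \<noteq> t"
          then obtain p where "spanning_path V ?H s p t"
            using \<open>hamilton_connected_on V ?H\<close> unfolding hamilton_connected_on_def by blast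
          then show "\<exists>p. spanning_path V H s p t"
            using spanning_path_without_heavy_edge[OF _ ab(1,2,4) heavy] H by blast
        qed
        then show False using H by simp
      qed
    qed
  qed
qed

section \<open>Structure of maximal graphs that are not Hamilton-connected\<close>

text \<open>
  A vertex of \<open>Q\<close> falls short of the maximal degree \<open>n - 1\<close> by at least \<open>k - 1\<close>, and a vertex of \<open>P\<close> by
  a further \<open>n - 2 k\<close>.
\<close>

lemma sum_le_of_degree_thresholds:
  fixes d :: "'a \<Rightarrow> nat" and n k :: nat
  assumes V: "finite V" "card V = n" and PQ: "P \<subseteq> Q" "Q \<subseteq> V"
    and k: "1 \<le> k" "2 * k \<le> n"
    and d: "\<And>v. v \<in> P \<Longrightarrow> d v \<le> k" "\<And>v. v \<in> Q \<Longrightarrow> d v \<le> n - k"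
      "\<And>v. v \<in> V \<Longrightarrow> d v \<le> n - 1"
  shows "int (\<Sum>v\<in>V. d v) + (int k - 1) * int (card Q) + (int n - 2 * int k) * int (card P)
           \<le> int n * (int n - 1)"
proof -
  let ?q = "\<lambda>v. if v \<in> Q then int k - 1 else 0"
  let ?p = "\<lambda>v. if v \<in> P then int n - 2 * int k else 0"
  have "(\<Sum>v\<in>V. int (d v) + ?q v + ?p v) \<le> (\<Sum>v\<in>V. int n - 1)"
  proof (rule sum_mono)
    fix v assume v: "v \<in> V"
    show "int (d v) + ?q v + ?p v \<le> int n - 1"
      using d(1)[of v] d(2)[of v] d(3)[OF v] k PQ by auto
  qed
  moreover have "(\<Sum>v\<in>V. ?q v) = (int k - 1) * int (card Q)"
    using V(1) PQ(2) by (simp add: sum.If_cases Int_absorb1)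
  moreover have "(\<Sum>v\<in>V. ?p v) = (int n - 2 * int k) * int (card P)"
    using V(1) PQ by (simp add: sum.If_cases Int_absorb1)
  ultimately show ?thesis using V(2) by (simp add: sum.distrib)
qed

text \<open>
  Choose a non-adjacent pair \<open>u\<close>, \<open>v\<close> with \<open>d u \<le> d v\<close> and \<open>d u + d v\<close> maximal.  By maximality the
  non-neighbours of \<open>v\<close> have degree at most \<open>d u\<close>, and there are at least \<open>d u - 1\<close> of them because
  \<open>d u + d v \<le> n\<close>.  Non-neighbours of \<open>u\<close> have degree at most \<open>n - d u\<close>, and so has \<open>u\<close> itself.
\<close>

lemma degree_closed_graph_thresholds:
  assumes G: "simple_graph V E" and n: "card V = n"
    and closed: "degree_closed V E"
    and incomplete: "a \<in> V" "b \<in> V" "a \<noteq> b" "(a, b) \<notin> E"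
  obtains u where "u \<in> V" "2 * valency E u \<le> n"
    "valency E u \<le> Suc (card {v \<in> V. valency E v \<le> valency E u})"
    "n - valency E u \<le> card {v \<in> V. valency E v \<le> n - valency E u}"
proof -
  note GD = simple_graphD[OF G]
  have sat: "valency E a + valency E b \<le> n"
    if "a \<in> V" "b \<in> V" "a \<noteq> b" "(a, b) \<notin> E" for a b
    using closed that n by (auto simp: degree_closed_def)
  let ?d = "valency E"
  let ?N = "\<lambda>e. fst e \<in> V \<and> snd e \<in> V \<and> fst e \<noteq> snd e \<and> e \<notin> E"
  have "\<exists>e. ?N e \<and> (\<forall>e'. ?N e' \<longrightarrow> ?d (fst e') + ?d (snd e') \<le> ?d (fst e) + ?d (snd e))"
    by (rule ex_has_greatest_nat[of ?N "(a, b)" _ "Suc n"])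
      (use incomplete sat in \<open>auto simp: less_Suc_eq_le\<close>)
  then obtain u' v' where "?N (u', v')"
    and "\<And>x y. ?N (x, y) \<Longrightarrow> ?d x + ?d y \<le> ?d u' + ?d v'"
    by auto
  moreover have "?N (v', u')" using \<open>?N (u', v')\<close> GD(6) by auto
  ultimately obtain u v where uv: "?N (u, v)" "?d u \<le> ?d v"
    and max: "\<And>x y. ?N (x, y) \<Longrightarrow> ?d x + ?d y \<le> ?d u + ?d v"
    by (metis add.commute nat_le_linear)
  let ?k = "?d u"
  have dv: "?k + ?d v \<le> n" using sat uv by simp
  have fin: "finite {x \<in> V. ?d x \<le> c}" for c using GD(1) by simp
  show ?thesis
  proof (rule that)
    show "u \<in> V" "2 * ?k \<le> n" using uv dv by auto
    have "V - insert v (E `` {v}) \<subseteq> {x \<in> V. ?d x \<le> ?k}"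
      using max[of _ v] uv(1) GD(6) by fastforce
    then have "card (V - insert v (E `` {v})) \<le> card {x \<in> V. ?d x \<le> ?k}"
      by (rule card_mono[OF fin])
    moreover have "card (V - insert v (E `` {v})) = n - Suc (?d v)"
      using GD(4,5,7) uv(1) n by (subst card_Diff_subset) auto
    ultimately show "?k \<le> Suc (card {x \<in> V. ?d x \<le> ?k})" using dv by linarith
    have "V - E `` {u} \<subseteq> {x \<in> V. ?d x \<le> n - ?k}"
    proof
      fix x assume x: "x \<in> V - E `` {u}"
      show "x \<in> {x \<in> V. ?d x \<le> n - ?k}"
      proof (cases "x = u")
        case True
        then show ?thesis using x dv uv(2) by simp
      next
        case False
        then have "?d u + ?d x \<le> n" using x uv(1) sat[of u x] by auto
        then show ?thesis using x by simp
      qed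
    qed
    then have "card (V - E `` {u}) \<le> card {x \<in> V. ?d x \<le> n - ?k}"
      by (rule card_mono[OF fin])
    moreover have "card (V - E `` {u}) = n - ?k"
      using GD(4,5) n by (subst card_Diff_subset) auto
    ultimately show "n - ?k \<le> card {x \<in> V. ?d x \<le> n - ?k}" by simp
  qed
qed

text \<open>
  A complete graph on all but two vertices, extended by two vertices of degree 3 with the same neighbours
  in it.  Leaving \<open>w1\<close> and \<open>w2\<close> out of each other's neighbourhood covers both extremal graphs: the twins
  have three common neighbours if they are not adjacent and two if they are.
\<close>

definition twin_extension :: "'a set \<Rightarrow> ('a \<times> 'a) set \<Rightarrow> 'a \<Rightarrow> 'a \<Rightarrow> bool" where
  "twin_extension V E w1 w2 \<longleftrightarrow> w1 \<in> V \<and> w2 \<in> V \<and> w1 \<noteq> w2 \<and>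
     (\<forall>x\<in>V - {w1, w2}. \<forall>y\<in>V - {w1, w2}. x \<noteq> y \<longrightarrow> (x, y) \<in> E) \<and>
     valency E w1 = 3 \<and> valency E w2 = 3 \<and> E `` {w1} - {w2} = E `` {w2} - {w1}"

text \<open>
  The quadratic hypothesis is equivalent to \<open>(k - 3) (2 n - 6 - 3 k) \<le> 4\<close>.  For \<open>k \<ge> 8\<close> the second factor is at
  least \<open>k - 6\<close>, so the product is too large; \<open>k = 7\<close>, \<open>n = 14\<close> attains equality.
\<close>

lemma degree_threshold_cases:
  fixes n k :: int
  assumes "14 \<le> n" "3 \<le> k" "2 * k \<le> n" "(k - 1) * (2 * n - 3 * k) \<le> 4 * n - 14"
  shows "k = 3 \<or> (n = 14 \<and> k = 7)"
proof -
  have *: "(k - 3) * (2 * n - 6 - 3 * k) \<le> 4"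
    using assms(4) by (simp add: algebra_simps)
  show ?thesis
  proof (cases "k \<ge> 8")
    case True
    then have "5 * 2 \<le> (k - 3) * (2 * n - 6 - 3 * k)"
      using assms(3) by (intro mult_mono) auto
    then show ?thesis using * by simp
  next
    case False
    then consider "k = 3" | "k = 4" | "k = 5" | "k = 6" | "k = 7" using assms(2) by linarith
    then show ?thesis using * assms(1) by cases auto
  qed
qed

text \<open>
  The edge count allows only two vertices \<open>w1\<close>, \<open>w2\<close> of degree 3.  Two non-adjacent vertices among the others
  would have degree sum at most \<open>n\<close>, which again costs too many edges; so the others form a clique.  A vertex
  of the clique adjacent to exactly one twin would have degree at least \<open>n - 2\<close> and, together with the
  other twin, degree sum at least \<open>n + 1\<close>.
\<close>

lemma degree_closed_graph_threshold_three:
  assumes G: "simple_graph V E" and n: "card V = n" "14 \<le> n"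
    and closed: "degree_closed V E"
    and deg: "\<forall>v\<in>V. 3 \<le> valency E v"
    and edges: "n\<^sup>2 + 14 \<le> card E + 5 * n"
    and P: "2 \<le> card {v \<in> V. valency E v \<le> 3}"
    and Q: "n - 3 \<le> card {v \<in> V. valency E v \<le> n - 3}"
  shows "\<exists>w1 w2. twin_extension V E w1 w2"
proof -
  note GD = simple_graphD[OF G]
  have sat: "valency E a + valency E b \<le> n"
    if "a \<in> V" "b \<in> V" "a \<noteq> b" "(a, b) \<notin> E" for a b
    using closed that n by (auto simp: degree_closed_def)
  let ?d = "valency E"
  let ?P = "{v \<in> V. ?d v \<le> 3}" and ?Q = "{v \<in> V. ?d v \<le> n - 3}"
  have E: "(\<Sum>v\<in>V. ?d v) = card E" by (rule sum_degree_eq_card[OF G])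
  have dn: "?d v \<le> n - 1" if "v \<in> V" for v using degree_le_card_diff_1[OF G that] n by simp
  have edges': "int n * int n + 14 \<le> int (card E) + 5 * int n"
  proof -
    have "int (n\<^sup>2 + 14) \<le> int (card E + 5 * n)" using edges by (simp only: of_nat_le_iff)
    then show ?thesis by (simp add: power2_eq_square)
  qed
  have "int (card E) + (int 3 - 1) * int (card ?Q) + (int n - 2 * int 3) * int (card ?P)
          \<le> int n * (int n - 1)"
    unfolding E[symmetric]
    by (rule sum_le_of_degree_thresholds[OF GD(1) n(1)]) (use n(2) dn in auto)
  then have "int (card E) + 2 * int (card ?Q) + (int n - 6) * int (card ?P) \<le> int n * (int n - 1)"
    by simp
  moreover have "(int n - 6) * 3 \<le> (int n - 6) * int (card ?P)" if "3 \<le> card ?P"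
    using that n by (intro mult_left_mono) auto
  ultimately have "\<not> 3 \<le> card ?P"
    using Q n edges' by (auto simp: algebra_simps)
  then have "card ?P = 2" using P by linarith
  then obtain w1 w2 where w: "?P = {w1, w2}" "w1 \<noteq> w2" by (auto simp: card_2_iff)
  then have wV: "w1 \<in> V" "w2 \<in> V" "?d w1 = 3" "?d w2 = 3"
    using deg by (auto intro: antisym)
  define R where "R = V - {w1, w2}"
  have cR: "card R = n - 2" using wV w(2) GD(1) n by (simp add: R_def)
  have clique: "(x, y) \<in> E" if xy: "x \<in> R" "y \<in> R" "x \<noteq> y" for x y
  proof (rule ccontr)
    assume no: "(x, y) \<notin> E"
    let ?W = "{w1, w2, x, y}"
    have W: "card ?W = 4" "?W \<subseteq> V" using xy w(2) wV by (auto simp: R_def)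
    have "(\<Sum>v\<in>V. ?d v) = (\<Sum>v\<in>V - ?W. ?d v) + (\<Sum>v\<in>?W. ?d v)"
      by (rule sum.subset_diff[OF W(2) GD(1)])
    also have "(\<Sum>v\<in>V - ?W. ?d v) \<le> (n - 4) * (n - 3) + (3 + 3)"
    proof -
      let ?i = "\<lambda>w v. if v \<in> E `` {w} then 1 else 0 :: nat"
      \<comment> \<open>Outside \<open>R\<close> only \<open>w1\<close> and \<open>w2\<close> can be neighbours, and these two send out just six arcs in total.\<close>
      have "?d v \<le> (n - 3) + (?i w1 v + ?i w2 v)" if v: "v \<in> V - ?W" for v
      proof -
        have "E `` {v} \<subseteq> (R - {v}) \<union> ((if v \<in> E `` {w1} then {w1} else {})
            \<union> (if v \<in> E `` {w2} then {w2} else {}))" (is "_ \<subseteq> _ \<union> (?A \<union> ?B)")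
          using GD(2,6,7) by (auto simp: R_def)
        then have "?d v \<le> card ((R - {v}) \<union> (?A \<union> ?B))"
          using GD(1) by (intro card_mono) (auto simp: R_def)
        also have "\<dots> \<le> card (R - {v}) + (card ?A + card ?B)"
          by (meson add_left_mono card_Un_le le_trans)
        finally show ?thesis using v cR GD(1) by (auto simp: R_def split: if_splits)
      qed
      then have "(\<Sum>v\<in>V - ?W. ?d v) \<le> (\<Sum>v\<in>V - ?W. (n - 3) + (?i w1 v + ?i w2 v))"
        by (rule sum_mono)
      also have "\<dots> = (n - 4) * (n - 3) + ((\<Sum>v\<in>V - ?W. ?i w1 v) + (\<Sum>v\<in>V - ?W. ?i w2 v))"
        using W n GD(1) by (simp only: sum.distrib sum_constant) (simp add: card_Diff_subset)
      finally have total: "(\<Sum>v\<in>V - ?W. ?d v)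
          \<le> (n - 4) * (n - 3) + ((\<Sum>v\<in>V - ?W. ?i w1 v) + (\<Sum>v\<in>V - ?W. ?i w2 v))" .
      have "(\<Sum>v\<in>V - ?W. ?i w v) \<le> ?d w" for w
      proof -
        have "(\<Sum>v\<in>V - ?W. ?i w v) = card ((V - ?W) \<inter> E `` {w})"
          using GD(1) by (simp add: sum.If_cases Image_singleton)
        also have "\<dots> \<le> ?d w" by (rule card_mono[OF GD(4)]) simp
        finally show ?thesis .
      qed
      from this[of w1] this[of w2] total show ?thesis using wV by linarith
    qed
    also have "(\<Sum>v\<in>?W. ?d v) = 6 + (?d x + ?d y)"
      using xy w(2) wV by (auto simp: R_def)
    also have "?d x + ?d y \<le> n" using sat[of x y] xy no by (auto simp: R_def)
    finally have "card E \<le> (n - 4) * (n - 3) + (3 + 3) + (6 + n)" using E by simp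
    then have "int (card E) \<le> int ((n - 4) * (n - 3) + (3 + 3) + (6 + n))"
      by (simp only: of_nat_le_iff)
    also have "\<dots> = (int n - 4) * (int n - 3) + 12 + int n" using n by (simp add: of_nat_diff)
    finally show False using edges' n by (simp add: algebra_simps)
  qed
  have common: "E `` {w} - {w'} \<subseteq> E `` {w'}"
    if ww: "{w, w'} = {w1, w2}" for w w'
  proof
    fix x assume x: "x \<in> E `` {w} - {w'}"
    show "x \<in> E `` {w'}"
    proof (rule ccontr)
      assume no: "x \<notin> E `` {w'}"
      have xR: "x \<in> R" using x ww GD(5,7) by (auto simp: R_def doubleton_eq_iff)
      have "insert w (R - {x}) \<subseteq> E `` {x}"
        using clique[OF xR] x GD(6) by auto
      then have "card (insert w (R - {x})) \<le> ?d x" by (rule card_mono[OF GD(4)])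
      moreover have "w \<notin> R" using ww by (auto simp: R_def)
      moreover have "finite R" using GD(1) by (simp add: R_def)
      ultimately have "n - 2 \<le> ?d x" using xR cR n by simp
      moreover have "?d w' + ?d x \<le> n"
        using ww wV xR no by (intro sat) (auto simp: R_def doubleton_eq_iff)
      moreover have "?d w' = 3" using ww wV by (auto simp: doubleton_eq_iff)
      ultimately show False using n by linarith
    qed
  qed
  have "E `` {w1} - {w2} = E `` {w2} - {w1}"
    using common[of w1 w2] common[of w2 w1] GD(7) by blast
  then have "twin_extension V E w1 w2"
    using wV w(2) clique by (auto simp: twin_extension_def R_def)
  then show ?thesis by blast
qed

text \<open>
  The degree thresholds and the edge count leave two values of \<open>k\<close>.  The second one occurs because the join
  of \<open>K\<^sub>7\<close> with seven isolated vertices is not Hamilton-connected and has exactly \<open>n\<^sup>2 - 5n + 14 = 140\<close> arcs.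
\<close>

lemma degree_closed_graph_cases:
  assumes G: "simple_graph V E" and n: "card V = n" "14 \<le> n"
    and nham: "\<not> hamilton_connected_on V E"
    and closed: "degree_closed V E"
    and deg: "\<forall>v\<in>V. 3 \<le> valency E v"
    and edges: "n\<^sup>2 + 14 \<le> card E + 5 * n"
  shows "(\<exists>w1 w2. twin_extension V E w1 w2) \<or>
    (n = 14 \<and> card E = 140 \<and> (\<forall>v\<in>V. 7 \<le> valency E v))"
proof -
  note GD = simple_graphD[OF G]
  let ?d = "valency E"
  have E: "(\<Sum>v\<in>V. ?d v) = card E" by (rule sum_degree_eq_card[OF G])
  have dn: "?d v \<le> n - 1" if "v \<in> V" for v using degree_le_card_diff_1[OF G that] n by simp
  have edges': "int n * int n + 14 \<le> int (card E) + 5 * int n"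
  proof -
    have "int (n\<^sup>2 + 14) \<le> int (card E + 5 * n)" using edges by (simp only: of_nat_le_iff)
    then show ?thesis by (simp add: power2_eq_square)
  qed
  obtain a b where ab: "a \<in> V" "b \<in> V" "a \<noteq> b" "(a, b) \<notin> E"
    using nham hamilton_connected_on_complete[OF GD(1)] by blast
  obtain u where u: "u \<in> V" "2 * ?d u \<le> n"
    "?d u \<le> Suc (card {v \<in> V. ?d v \<le> ?d u})"
    "n - ?d u \<le> card {v \<in> V. ?d v \<le> n - ?d u}"
    by (rule degree_closed_graph_thresholds[OF G n(1) closed ab]) (rule that)
  define k where "k = ?d u"
  define P where "P = {v \<in> V. ?d v \<le> k}"
  define Q where "Q = {v \<in> V. ?d v \<le> n - k}"
  have k: "3 \<le> k" "2 * k \<le> n" using deg u by (auto simp: k_def)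
  have P: "k \<le> Suc (card P)" and Q: "n - k \<le> card Q"
    using u by (auto simp: k_def P_def Q_def)
  have PQ: "P \<subseteq> Q" "Q \<subseteq> V" using k by (auto simp: P_def Q_def)
  have "int (card E) + (int k - 1) * int (card Q) + (int n - 2 * int k) * int (card P)
          \<le> int n * (int n - 1)"
    unfolding E[symmetric]
    by (rule sum_le_of_degree_thresholds[OF GD(1) n(1) PQ])
      (use k dn in \<open>auto simp: P_def Q_def\<close>)
  moreover have "(int k - 1) * (int n - int k) \<le> (int k - 1) * int (card Q)"
    using k Q by (intro mult_left_mono) linarith+
  moreover have "(int n - 2 * int k) * (int k - 1) \<le> (int n - 2 * int k) * int (card P)"
    using k P by (intro mult_left_mono) linarith+
  ultimately have ineq: "(int k - 1) * (2 * int n - 3 * int k) \<le> 4 * int n - 14"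
    using edges' by (simp add: algebra_simps)
  have "int k = 3 \<or> (int n = 14 \<and> int k = 7)"
    by (rule degree_threshold_cases) (use ineq n k in auto)
  then consider "k = 3" | "n = 14" "k = 7" by linarith
  then show ?thesis
  proof cases
    case 1
    have "2 \<le> card {v \<in> V. ?d v \<le> 3}" "n - 3 \<le> card {v \<in> V. ?d v \<le> n - 3}"
      using P Q 1 by (auto simp: P_def Q_def)
    then show ?thesis
      using degree_closed_graph_threshold_three[OF G n closed deg edges] by blast
  next
    case 2
    have bound: "(\<Sum>v\<in>V. d v) \<le> 140"
      if "\<And>v. v \<in> P \<Longrightarrow> d v \<le> 7" "\<And>v. v \<in> V \<Longrightarrow> d v \<le> 13" for d :: "'a \<Rightarrow> nat"
    proof -
      have "int (\<Sum>v\<in>V. d v) + (int 7 - 1) * int (card P) + (int 14 - 2 * int 7) * int (card P)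
          \<le> int 14 * (int 14 - 1)"
        by (rule sum_le_of_degree_thresholds[of V 14 P P 7 d])
          (use that PQ 2 GD(1) n in auto)
      moreover have "7 \<le> card P" using Q 2 by (simp add: P_def Q_def)
      ultimately have "int (\<Sum>v\<in>V. d v) \<le> int 140" by simp
      then show ?thesis by (simp only: of_nat_le_iff)
    qed
    have "card E = 140"
      using bound[of ?d] dn 2 edges E by (simp add: P_def)
    moreover have "7 \<le> ?d w" if w: "w \<in> V" for w
    proof (rule ccontr)
      \<comment> \<open>Raising the degree of \<open>w\<close> by one still respects all thresholds, but the sum 140 is already maximal.\<close>
      assume "\<not> 7 \<le> ?d w"
      then have "(\<Sum>v\<in>V. (?d(w := Suc (?d w))) v) \<le> 140"
        using dn 2 by (intro bound) (auto simp: P_def)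
      moreover have "(\<Sum>v\<in>V. (?d(w := Suc (?d w))) v) = Suc (\<Sum>v\<in>V. ?d v)"
        using w GD(1) by (simp add: sum.remove)
      ultimately show False using E \<open>card E = 140\<close> by simp
    qed
    ultimately show ?thesis using 2 by blast
  qed
qed

section \<open>Spanning subgraphs of the extremal graphs\<close>

text \<open>
  Put \<open>N = n - 3\<close>.  The clique has \<open>N + 1\<close> vertices, so by itself it has the constant eigenvector with
  eigenvalue \<open>N\<close>.  The test vector perturbs the constant \<open>3 (N + 2)\<close> by \<open>+2\<close> at the (at most three) neighbours
  of the twins and by \<open>-3\<close> at the two ends of the missing edge.  The perturbations sum to at most zero
  over the clique; the gain of \<open>2 (N + 1)\<close> in \<open>(N + 1) z\<close> at a neighbour of the twins pays for the two entries
  \<open>N + 1\<close> of the twins; and the loss of \<open>3 (N + 1)\<close> at an end of the missing edge is covered by the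
  absent neighbour, whose entry is at least \<open>3 (N + 1)\<close>.  At the twins the inequality comes down to
  \<open>3 (3 N + 8) \<le> N (N + 1)\<close>, which holds since \<open>N \<ge> 11\<close>.
\<close>

lemma spectral_radius_proper_subgraph_of_twin_extension:
  fixes G :: "'a pair_pre_digraph"
  defines "V \<equiv> pverts G" and "E \<equiv> parcs G"
  assumes G: "simple_graph V E" and H: "simple_graph V H" and tw: "twin_extension V H w1 w2"
    and n: "card V = n" "14 \<le> n"
    and sub: "E \<subseteq> H" and e: "(a, b) \<in> H" "(a, b) \<notin> E" "a \<notin> {w1, w2}" "b \<notin> {w1, w2}"
  shows "graph_spectral_radius G \<le> real n - 3"
proof -
  note GD = simple_graphD[OF G] and HD = simple_graphD[OF H]
  define N where "N = real n - 3"
  have N: "N \<ge> 11" using n by (simp add: N_def)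
  define C where "C = H `` {w1} - {w2}"
  define R where "R = V - {w1, w2}"
  have w: "w1 \<in> V" "w2 \<in> V" "w1 \<noteq> w2" "valency H w1 = 3" "valency H w2 = 3" "C = H `` {w2} - {w1}"
    using tw by (auto simp: twin_extension_def C_def)
  have ab: "a \<in> R" "b \<in> R" "a \<noteq> b" using e HD(2,7) by (auto simp: R_def)
  have Rab: "R \<inter> {v. v = a \<or> v = b} = {a, b}" using ab by auto
  have CR: "C \<subseteq> R" using HD(5,7) w(6) by (auto simp: C_def R_def)
  have "card C \<le> 3"
    using w(4) card_mono[OF HD(4), of C w1] by (auto simp: C_def)
  have R: "finite R" "real (card R) = N + 1"
    using w n HD(1) by (auto simp: R_def N_def)
  define z :: "'a \<Rightarrow> real" where
    "z v = (if v \<in> {w1, w2} then N + 1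
      else 3 * (N + 2) + (if v \<in> C then 2 else 0) - (if v \<in> {a, b} then 3 else 0))" for v
  have z_R: "z v \<ge> 3 * (N + 1)" if "v \<in> R" for v using that by (auto simp: z_def R_def)
  have z_ub: "z v \<le> 3 * N + 8" for v using N by (auto simp: z_def)
  have pos: "z v > 0" for v using N by (auto simp: z_def)
  have "(\<Sum>v\<in>R. z v) = (\<Sum>v\<in>R. 3 * (N + 2) + (if v \<in> C then 2 else 0) - (if v \<in> {a, b} then 3 else 0))"
    by (intro sum.cong) (auto simp: z_def R_def)
  also have "\<dots> = 3 * (N + 2) * (N + 1) + 2 * real (card C) - 6"
    using R CR ab(3) Rab by (simp add: sum.distrib sum_subtractf sum.If_cases Int_absorb1)
  also have "\<dots> \<le> 3 * (N + 2) * (N + 1)" using \<open>card C \<le> 3\<close> by simp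
  finally have sum_R: "(\<Sum>v\<in>R. z v) \<le> 3 * (N + 2) * (N + 1)" .
  have "(\<Sum>u\<in>E `` {v}. z u) \<le> N * z v" if v: "v \<in> V" for v
  proof (cases "v \<in> {w1, w2}")
    case True
    have "E `` {v} \<subseteq> H `` {v}" using sub by auto
    then have "card (E `` {v}) \<le> valency H v" by (rule card_mono[OF HD(4)])
    then have "card (E `` {v}) \<le> 3" using True w(4,5) by auto
    have "(\<Sum>u\<in>E `` {v}. z u) \<le> real (card (E `` {v})) * (3 * N + 8)"
      using z_ub by (intro sum_bounded_above) simp
    moreover have "real (card (E `` {v})) * (3 * N + 8) \<le> 3 * (3 * N + 8)"
      using N \<open>card (E `` {v}) \<le> 3\<close> by (intro mult_right_mono) auto
    ultimately have "(\<Sum>u\<in>E `` {v}. z u) \<le> 3 * (3 * N + 8)" by linarith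
    also have "\<dots> \<le> N * (N + 1)"
    proof -
      have "0 \<le> (N - 11) * (N + 3) + 9" using N by simp
      then show ?thesis by (simp add: algebra_simps)
    qed
    finally show ?thesis using True by (auto simp: z_def)
  next
    case False
    then have vR: "v \<in> R" using v by (simp add: R_def)
    \<comment> \<open>\<open>M\<close> holds the neighbour lost with the missing edge, \<open>W\<close> the twins that may be adjacent to \<open>v\<close>.\<close>
    define M where "M = (if v = a then {b} else if v = b then {a} else {})"
    define W where "W = (if v \<in> C then {w1, w2} else {})"
    have M: "finite M" "v \<notin> M" "M \<subseteq> R" using ab by (auto simp: M_def)
    have "E `` {v} \<subseteq> (R - insert v M) \<union> W"
    proof
      fix u assume u: "u \<in> E `` {v}"
      then have "(v, u) \<in> H" "u \<in> V" "u \<noteq> v" using sub GD(2,7) by auto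
      moreover have "u \<notin> M" using u e(2) GD(6) by (auto simp: M_def split: if_splits)
      moreover have "v \<in> C" if "u \<in> {w1, w2}"
        using that \<open>(v, u) \<in> H\<close> HD(6) False w(6) by (auto simp: C_def)
      ultimately show "u \<in> (R - insert v M) \<union> W" by (auto simp: R_def W_def)
    qed
    then have "(\<Sum>u\<in>E `` {v}. z u) \<le> (\<Sum>u\<in>(R - insert v M) \<union> W. z u)"
      using R(1) pos by (intro sum_mono2) (auto simp: W_def less_imp_le)
    also have "\<dots> = (\<Sum>u\<in>R - insert v M. z u) + (\<Sum>u\<in>W. z u)"
      using R(1) by (intro sum.union_disjoint) (auto simp: W_def R_def)
    also have "(\<Sum>u\<in>R - insert v M. z u) = (\<Sum>u\<in>R. z u) - (z v + (\<Sum>u\<in>M. z u))"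
      using M vR R(1) by (simp add: sum_diff)
    also have "(\<Sum>u\<in>W. z u) = (if v \<in> C then 2 * (N + 1) else 0)"
      using w(3) by (simp add: W_def z_def)
    finally have *: "(\<Sum>u\<in>E `` {v}. z u) \<le> 3 * (N + 2) * (N + 1) - z v - (\<Sum>u\<in>M. z u)
        + (if v \<in> C then 2 * (N + 1) else 0)"
      using sum_R by simp
    moreover have "(\<Sum>u\<in>M. z u) \<ge> (if v \<in> {a, b} then 3 * (N + 1) else 0)"
      using z_R ab by (simp add: M_def)
    moreover have "(N + 1) * z v = 3 * (N + 2) * (N + 1) + (if v \<in> C then 2 * (N + 1) else 0)
        - (if v \<in> {a, b} then 3 * (N + 1) else 0)"
      using False by (simp add: z_def algebra_simps)
    ultimately show ?thesis by (simp add: algebra_simps)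
  qed
  then show ?thesis
    using spectral_radius_le_of_positive_vector[of G N z] G N pos w(1)
    unfolding V_def E_def N_def by auto
qed

section \<open>Recognising the extremal graphs\<close>

lemma digraph_isoI:
  assumes wf: "simple_graph (pverts G) (parcs G)" and H: "parcs H \<subseteq> pverts H \<times> pverts H"
    and bij: "bij_betw f (pverts G) (pverts H)"
    and arcs: "\<And>u v. u \<in> pverts G \<Longrightarrow> v \<in> pverts G \<Longrightarrow> (u, v) \<in> parcs G \<longleftrightarrow> (f u, f v) \<in> parcs H"
  shows "digraph_iso (with_proj G) (with_proj H)"
proof -
  note GD = simple_graphD[OF wf]
  let ?h = "\<lparr>iso_verts = f, iso_arcs = map_prod f f, iso_head = snd, iso_tail = fst\<rparr>"
  have inj: "inj_on f (pverts G)" and surj: "f ` pverts G = pverts H"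
    using bij by (auto simp: bij_betw_def)
  have "wf_digraph (with_proj G)"
    using GD(2) by unfold_locales auto
  moreover have "inj_on (map_prod f f) (parcs G)"
    using map_prod_inj_on[OF inj inj] GD(2) by (rule inj_on_subset)
  ultimately have "pre_digraph.digraph_isomorphism (with_proj G) ?h"
    using inj by (auto simp: pre_digraph.digraph_isomorphism_def)
  moreover have "map_prod f f ` parcs G = parcs H"
  proof
    show "map_prod f f ` parcs G \<subseteq> parcs H" using arcs GD(2) by auto
    show "parcs H \<subseteq> map_prod f f ` parcs G"
    proof
      fix e assume e: "e \<in> parcs H"
      then obtain u v where "u \<in> pverts G" "v \<in> pverts G" "e = (f u, f v)"
        using H surj by (smt (verit) SigmaE imageE subsetD)
      then show "e \<in> map_prod f f ` parcs G" using arcs e by force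
    qed
  qed
  then have "with_proj H = app_iso ?h (with_proj G)"
    by (simp add: app_iso_def with_proj_def surj)
  ultimately show ?thesis unfolding digraph_iso_def by blast
qed

lemma S3_graph_simps:
  "pverts (S3_graph n) = Inl ` {0..<3} \<union> (Inr \<circ> Inl) ` {0..<n - 5} \<union> {Inr (Inr (0, 0)), Inr (Inr (1, 0))}"
  "(Inl i, Inl j) \<in> parcs (S3_graph n) \<longleftrightarrow> i < 3 \<and> j < 3 \<and> i \<noteq> j"
  "(Inl i, Inr r) \<in> parcs (S3_graph n) \<longleftrightarrow> i < 3 \<and> Inr r \<in> pverts (S3_graph n)"
  "(Inr r, Inl i) \<in> parcs (S3_graph n) \<longleftrightarrow> i < 3 \<and> Inr r \<in> pverts (S3_graph n)"
  "(Inr (Inl k), Inr (Inl l)) \<in> parcs (S3_graph n) \<longleftrightarrow> k < n - 5 \<and> l < n - 5 \<and> k \<noteq> l"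
  "(Inr (Inl k), Inr (Inr p)) \<notin> parcs (S3_graph n)"
  "(Inr (Inr p), Inr (Inl k)) \<notin> parcs (S3_graph n)"
  "(Inr (Inr p), Inr (Inr q)) \<notin> parcs (S3_graph n)"
  "parcs (S3_graph n) \<subseteq> pverts (S3_graph n) \<times> pverts (S3_graph n)"
  by (auto simp: S3_graph_def join_def disjoint_union_def copies_def complete_graph_def image_iff
      less_Suc_eq numeral_2_eq_2)

lemma T3_graph_simps:
  "pverts (T3_graph n) = Inl ` {0..<2} \<union> (Inr \<circ> Inl) ` {0..<n - 4} \<union> {Inr (Inr 0), Inr (Inr 1)}"
  "(Inl i, Inl j) \<in> parcs (T3_graph n) \<longleftrightarrow> i < 2 \<and> j < 2 \<and> i \<noteq> j"
  "(Inl i, Inr r) \<in> parcs (T3_graph n) \<longleftrightarrow> i < 2 \<and> Inr r \<in> pverts (T3_graph n)"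
  "(Inr r, Inl i) \<in> parcs (T3_graph n) \<longleftrightarrow> i < 2 \<and> Inr r \<in> pverts (T3_graph n)"
  "(Inr (Inl k), Inr (Inl l)) \<in> parcs (T3_graph n) \<longleftrightarrow> k < n - 4 \<and> l < n - 4 \<and> k \<noteq> l"
  "(Inr (Inl k), Inr (Inr p)) \<notin> parcs (T3_graph n)"
  "(Inr (Inr p), Inr (Inl k)) \<notin> parcs (T3_graph n)"
  "(Inr (Inr p), Inr (Inr q)) \<in> parcs (T3_graph n) \<longleftrightarrow> p < 2 \<and> q < 2 \<and> p \<noteq> q"
  "parcs (T3_graph n) \<subseteq> pverts (T3_graph n) \<times> pverts (T3_graph n)"
  by (auto simp: T3_graph_def join_def disjoint_union_def complete_graph_def image_iff
      less_Suc_eq numeral_2_eq_2)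

text \<open>
  The vertex sets of both extremal graphs have the shape on the right: the common neighbours of the twins,
  the rest of the clique, and the twins, which are pairs in one graph and numbers in the other.
\<close>

lemma bij_betw_blocks:
  assumes g: "bij_betw g C {0..<c}" and h: "bij_betw h D {0..<d}"
    and disj: "C \<inter> D = {}" "w1 \<notin> C \<union> D" "w2 \<notin> C \<union> D" "w1 \<noteq> w2" "p \<noteq> q"
    and f: "\<And>v. f v = (if v = w1 then Inr (Inr p) else if v = w2 then Inr (Inr q)
      else if v \<in> C then Inl (g v) else Inr (Inl (h v)))"
  shows "bij_betw f (C \<union> D \<union> {w1, w2})
    (Inl ` {0..<c} \<union> (Inr \<circ> Inl) ` {0..<d} \<union> {Inr (Inr p), Inr (Inr q)})"
proof (rule bij_betw_combine)
  have "bij_betw f C (Inl ` {0..<c})"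
  proof -
    have "bij_betw (Inl \<circ> g) C (Inl ` {0..<c})"
      by (rule bij_betw_trans[OF g]) (simp add: bij_betw_def)
    then show ?thesis
      by (rule bij_betw_cong[THEN iffD1, rotated]) (use disj in \<open>auto simp: f\<close>)
  qed
  moreover have "bij_betw f D ((Inr \<circ> Inl) ` {0..<d})"
  proof -
    have "bij_betw ((Inr \<circ> Inl) \<circ> h) D ((Inr \<circ> Inl) ` {0..<d})"
      by (rule bij_betw_trans[OF h]) (simp add: bij_betw_def inj_on_def)
    then show ?thesis
      by (rule bij_betw_cong[THEN iffD1, rotated]) (use disj in \<open>auto simp: f\<close>)
  qed
  ultimately show "bij_betw f (C \<union> D) (Inl ` {0..<c} \<union> (Inr \<circ> Inl) ` {0..<d})"
    by (rule bij_betw_combine) auto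
  show "bij_betw f {w1, w2} {Inr (Inr p), Inr (Inr q)}"
    using disj by (auto simp: bij_betw_def f)
qed auto

lemma twin_extension_iso:
  fixes G :: "'a pair_pre_digraph"
  assumes G: "simple_graph (pverts G) (parcs G)" and tw: "twin_extension (pverts G) (parcs G) w1 w2"
    and n: "card (pverts G) = n" 
  shows "digraph_iso (with_proj G) (with_proj (S3_graph n))
    \<or> digraph_iso (with_proj G) (with_proj (T3_graph n))"
proof -
  let ?V = "pverts G" and ?E = "parcs G"
  note GD = simple_graphD[OF G]
  define C where "C = ?E `` {w1} - {w2}"
  define D where "D = ?V - {w1, w2} - C"
  have w: "w1 \<in> ?V" "w2 \<in> ?V" "w1 \<noteq> w2" "valency ?E w1 = 3" "valency ?E w2 = 3" "C = ?E `` {w2} - {w1}"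
    and clique: "\<And>x y. x \<in> ?V - {w1, w2} \<Longrightarrow> y \<in> ?V - {w1, w2} \<Longrightarrow> x \<noteq> y \<Longrightarrow> (x, y) \<in> ?E"
    using tw by (auto simp: twin_extension_def C_def)
  have C: "C \<subseteq> ?V - {w1, w2}" using GD(5,7) w(6) by (auto simp: C_def)
  have V: "?V = C \<union> D \<union> {w1, w2}" using C w by (auto simp: D_def)
  have disj: "C \<inter> D = {}" "w1 \<notin> C \<union> D" "w2 \<notin> C \<union> D" using C by (auto simp: D_def)
  have fin: "finite C" "finite D" using GD(1) V by (metis finite_Un)+
  have cD: "card D = n - 2 - card C"
    using V disj w(3) fin n by (simp add: card_Un_disjoint)
  have adj: "(x, y) \<in> ?E \<longleftrightarrow> x \<noteq> y" if "x \<in> C \<union> D" "y \<in> C \<union> D" for x y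
    using clique[of x y] that GD(7) C by (auto simp: D_def)
  have adjw: "(x, w) \<in> ?E \<longleftrightarrow> x \<in> C" "(w, x) \<in> ?E \<longleftrightarrow> x \<in> C" if "x \<in> C \<union> D" "w \<in> {w1, w2}" for x w
    using that disj w(6) GD(6) by (auto simp: C_def)
  obtain g where g: "bij_betw g C {0..<card C}" using ex_bij_betw_finite_nat[OF fin(1)] by blast
  obtain h where h: "bij_betw h D {0..<card D}" using ex_bij_betw_finite_nat[OF fin(2)] by blast
  have gC: "g x < card C" if "x \<in> C" for x using g that by (auto dest: bij_betwE)
  have hD: "h x < card D" if "x \<in> D" for x using h that by (auto dest: bij_betwE)
  have g_inj: "g x = g y \<longleftrightarrow> x = y" if "x \<in> C" "y \<in> C" for x y
    using g that by (auto simp: bij_betw_def inj_on_eq_iff)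
  have h_inj: "h x = h y \<longleftrightarrow> x = y" if "x \<in> D" "y \<in> D" for x y
    using h that by (auto simp: bij_betw_def inj_on_eq_iff)
  note facts = adj adjw gC hD g_inj h_inj GD(7)
  have case_V: thesis if "v \<in> ?V" "v = w1 \<Longrightarrow> thesis" "v = w2 \<Longrightarrow> thesis" "v \<in> C \<Longrightarrow> thesis" "v \<in> D \<Longrightarrow> thesis"
    for v thesis using that V by auto
  show ?thesis
  proof (cases "(w1, w2) \<in> ?E")
    case False
    then have "C = ?E `` {w1}" by (auto simp: C_def)
    then have c: "card C = 3" "card D = n - 5" using w(4) cD by auto
    define f :: "'a \<Rightarrow> nat + nat + nat \<times> nat" where
      "f v = (if v = w1 then Inr (Inr (0, 0)) else if v = w2 then Inr (Inr (1, 0))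
        else if v \<in> C then Inl (g v) else Inr (Inl (h v)))" for v
    have f: "f w1 = Inr (Inr (0, 0))" "f w2 = Inr (Inr (1, 0))"
      "\<And>v. v \<in> C \<Longrightarrow> f v = Inl (g v)" "\<And>v. v \<in> D \<Longrightarrow> f v = Inr (Inl (h v))"
      using w(3) disj by (auto simp: f_def)
    have "bij_betw f ?V (pverts (S3_graph n))"
      unfolding V S3_graph_simps(1) c[symmetric]
      by (rule bij_betw_blocks[OF g h disj w(3) _ f_def]) simp
    moreover have "(u, v) \<in> ?E \<longleftrightarrow> (f u, f v) \<in> parcs (S3_graph n)" if "u \<in> ?V" "v \<in> ?V" for u v
      by (rule case_V[OF that(1)]; rule case_V[OF that(2)])
        (use facts disj False GD(6)[of w2 w1] c in \<open>auto simp: f S3_graph_simps\<close>)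
    ultimately show ?thesis
      using digraph_isoI[OF G S3_graph_simps(9)] by blast
  next
    case True
    then have "?E `` {w1} = insert w2 C" by (auto simp: C_def)
    then have "card C = 2" using w(4) disj fin by simp
    then have c: "card C = 2" "card D = n - 4" using cD by auto
    define f :: "'a \<Rightarrow> nat + nat + nat" where
      "f v = (if v = w1 then Inr (Inr 0) else if v = w2 then Inr (Inr 1)
        else if v \<in> C then Inl (g v) else Inr (Inl (h v)))" for v
    have f: "f w1 = Inr (Inr 0)" "f w2 = Inr (Inr 1)"
      "\<And>v. v \<in> C \<Longrightarrow> f v = Inl (g v)" "\<And>v. v \<in> D \<Longrightarrow> f v = Inr (Inl (h v))"
      using w(3) disj by (auto simp: f_def)
    have "bij_betw f ?V (pverts (T3_graph n))"
      unfolding V T3_graph_simps(1) c[symmetric]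
      by (rule bij_betw_blocks[OF g h disj w(3) _ f_def]) simp
    moreover have "(u, v) \<in> ?E \<longleftrightarrow> (f u, f v) \<in> parcs (T3_graph n)" if "u \<in> ?V" "v \<in> ?V" for u v
      by (rule case_V[OF that(1)]; rule case_V[OF that(2)])
        (use facts disj True GD(6)[of w1 w2] c in \<open>auto simp: f T3_graph_simps\<close>)
    ultimately show ?thesis
      using digraph_isoI[OF G T3_graph_simps(9)] by blast
  qed
qed

section \<open>Graphs of large spectral radius\<close>

lemma simple_graph_if_pair_graph:
  assumes "pair_graph G"
  shows "simple_graph (pverts G) (parcs G)"
proof -
  interpret pair_graph G by fact
  show ?thesis
    unfolding simple_graph_def
    using pair_finite_verts arc_fst_in_verts arc_snd_in_verts arcs_symmetric pair_no_loops
    by (fastforce simp: sym_def irrefl_def)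
qed

lemma out_degree_with_proj: "out_degree (with_proj G) v = valency (parcs G) v"
proof -
  have "out_arcs (with_proj G) v = Pair v ` (parcs G `` {v})"
    by (auto simp: out_arcs_def)
  then show ?thesis
    by (simp add: out_degree_def card_image inj_on_def)
qed

theorem theorem1p8:
  fixes G :: "'a pair_pre_digraph" and n :: nat
  assumes "pair_graph G"
    and "Digraph_Component.connected (with_proj G)"
    and "card (pverts G) = n"
    and "n \<ge> 14"
    and "min_degree G \<ge> 3"
    and "graph_spectral_radius G > real n - 3"
  shows "hamilton_connected G
    \<or> digraph_iso (with_proj G) (with_proj (S3_graph n))
    \<or> digraph_iso (with_proj G) (with_proj (T3_graph n))"
proof (rule disjCI)
  let ?V = "pverts G" and ?E = "parcs G" and ?r = "graph_spectral_radius G"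
  assume no_iso: "\<not> (digraph_iso (with_proj G) (with_proj (S3_graph n))
    \<or> digraph_iso (with_proj G) (with_proj (T3_graph n)))"
  note n = assms(3,4) and rho = assms(6)
  have G: "simple_graph ?V ?E" by (rule simple_graph_if_pair_graph[OF assms(1)])
  note GD = simple_graphD[OF G]
  have ne: "?V \<noteq> {}" using n by auto
  have deg: "3 \<le> valency ?E v" if "v \<in> ?V" for v
  proof -
    have "min_degree G \<le> out_degree (with_proj G) v"
      unfolding min_degree_def using that GD(1) by (intro Min_le) auto
    then show ?thesis using assms(5) by (simp add: out_degree_with_proj)
  qed
  \<comment> \<open>The left-hand side increases with \<open>\<rho>\<close>, so \<open>\<rho>\<close> may be replaced by \<open>n - 3\<close>.\<close>
  have "?r\<^sup>2 - 2 * ?r \<le> card ?E - (real n - 1) * 3"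
    using spectral_radius_edge_bound[OF G ne, of 3] deg rho n by force
  moreover have "(?r - (real n - 3)) * (?r + (real n - 3) - 2) > 0"
    using rho n by (intro mult_pos_pos) auto
  ultimately have "real (card ?E) > (real n)\<^sup>2 - 5 * real n + 12"
    by (simp add: algebra_simps power2_eq_square)
  then have "real (n\<^sup>2 + 12) < real (card ?E + 5 * n)" by simp
  then have "n\<^sup>2 + 12 < card ?E + 5 * n" by (simp only: of_nat_less_iff)
  moreover have "even (card ?E)" by (rule even_card_edges[OF G])
  moreover have "even (n\<^sup>2 + 5 * n)" by simp
  ultimately have edges: "n\<^sup>2 + 14 \<le> card ?E + 5 * n"
    by presburger
  show "hamilton_connected G"
  proof (rule ccontr)
    assume "\<not> hamilton_connected G"
    then have "\<not> hamilton_connected_on ?V ?E" using hamilton_connected_if_on_arcs by blast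
    then obtain H where H: "?E \<subseteq> H" "simple_graph ?V H" "\<not> hamilton_connected_on ?V H"
      and closed: "degree_closed ?V H"
      by (rule exists_saturated_supergraph[OF G])
    note HD = simple_graphD[OF H(2)]
    have nb: "?E `` {v} \<subseteq> H `` {v}" for v using H(1) by auto
    have degH: "\<forall>v\<in>?V. 3 \<le> valency H v"
      using deg card_mono[OF HD(4) nb] le_trans by blast
    have cardH: "card ?E \<le> card H" by (rule card_mono[OF HD(3) H(1)])
    then have edgesH: "n\<^sup>2 + 14 \<le> card H + 5 * n" using edges by simp
    consider w1 w2 where "twin_extension ?V H w1 w2"
      | "n = 14" "card H = 140" "\<And>v. v \<in> ?V \<Longrightarrow> 7 \<le> valency H v"
      using degree_closed_graph_cases[OF H(2) n H(3) closed degH edgesH] by blast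
    then show False
    proof cases
      case 1
      show ?thesis
      proof (cases "?E = H")
        case True
        then show ?thesis using twin_extension_iso[OF G _ n(1)] 1 no_iso by blast
      next
        case False
        then obtain a b where ab: "(a, b) \<in> H" "(a, b) \<notin> ?E" using H(1) by auto
        \<comment> \<open>The twins have degree 3 in \<open>H\<close>, so the minimum degree of \<open>G\<close> forbids losing an edge at them.\<close>
        have "?E `` {w} = H `` {w}" if "w \<in> {w1, w2}" for w
        proof (rule card_seteq[OF HD(4) nb])
          have "w \<in> ?V" "valency H w = 3" using 1 that by (auto simp: twin_extension_def)
          then show "valency H w \<le> valency ?E w" using deg by simp
        qed
        then have "a \<notin> {w1, w2}" "b \<notin> {w1, w2}"
          using ab HD(6) GD(6) by (metis Image_singleton_iff)+
        then have "?r \<le> real n - 3"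
          using spectral_radius_proper_subgraph_of_twin_extension[OF G H(2) 1 n H(1) ab] by blast
        then show ?thesis using rho by simp
      qed
    next
      case 2
      have "?E = H"
        by (rule card_seteq[OF HD(3) H(1)]) (use edges 2 in simp)
      then have "?r\<^sup>2 - 6 * ?r \<le> 140 - 13 * 7"
        using spectral_radius_edge_bound[OF G ne, of 7] 2 rho n by force
      moreover have "(?r - 11) * (?r + 5) > 0"
        using rho 2(1) by (intro mult_pos_pos) auto
      ultimately show False by (simp add: algebra_simps power2_eq_square)
    qed
  qed
qed

end
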